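(* Let $L$ be a finite lattice with $\tilde{L}$, $w_p$ and $H(L)$ as in the context, and let $T$ be a t-norm on $C(\tilde L)=A(\tilde L)\cup\{0,1\}$. Let $\overline{T}$ be the t-norm on $\tilde L$ given by $\overline{T}(x,y)=\bigvee_{u\in\kappa(x)}\bigvee_{v\in\kappa(y)}T(u,v)$, with $\kappa(x)=\{u\in C(\tilde L)\setminus\{0\}\mid u\le x\}$. Then the restriction $\overline{T}|_L$ of $\overline{T}$ to $L\times L$ is a t-norm on $L$ if and only if $T$ satisfies condition (C): for every $p\in H(L)\setminus\{1\}$, if $T(w_p,w_p)\ne 0$ then there exists $u\in A_{\tilde L}(p)\setminus\{w_p\}$ with $T(u,u)\ne0$.
   Context: For a lattice $L$ with bottom $0$, an atom is an element covering $0$; $A(L)$ is the set of atoms; $J(L)$ is the set of non-zero join-irreducible elements ($q\ne0$ with $q=x\vee y\Rightarrow q\in\{x,y\}$); $H(L)=J(L)\setminus A(L)$. The lattice $\tilde L$ is obtained from the finite lattice $L$ by adding, for each $p\in H(L)$, a new distinct element $w_p$ with $0\prec w_p\prec p$ (i.e., $w_p\le x$ for $x\in L$ iff $p\le x$, and $0< w_p$); $\tilde L=L\cup\{w_p\mid p\in H(L)\}$. Then $\tilde L$ is a finite atomistic lattice with $A(\tilde L)=A(L)\cup\{w_p\mid p\in H(L)\}$, $L$ is a (cover-preserving) sublattice of $\tilde L$ with the same $0$ and $1$. $A_{\tilde L}(x)=\{a\in A(\tilde L)\mid a\le x\}$. $C(\tilde L)=A(\tilde L)\cup\{0,1\}$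 has the order inherited from $\tilde L$. A t-norm on a bounded poset with top $1$ is a binary operation that is monotone in each argument, commutative, associative, with neutral element $1$. *)

theory Defs
  imports "HOL-Library.Finite_Lattice"
begin

section \<open>Atoms, join-irreducible elements and t-norms\<close>

definition covers :: "'a::order \<Rightarrow> 'a \<Rightarrow> bool" where
  "covers y x \<longleftrightarrow> x < y \<and> (\<nexists>z. x < z \<and> z < y)"

definition atoms :: "'a::order_bot set" where
  "atoms = {a. covers a bot}"

definition atoms_below :: "'a::order_bot \<Rightarrow> 'a set" where
  "atoms_below x = {a \<in> atoms. a \<le> x}"

definition join_irreducibles :: "'a::bounded_lattice_bot set" where
  "join_irreducibles = {q. q \<noteq> bot \<and> (\<forall>x y. q = sup x y \<longrightarrow> q = x \<or> q = y)}"

definition nonatom_irreducibles :: "'a::bounded_lattice_bot set" where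
  "nonatom_irreducibles = join_irreducibles - atoms"

text \<open>The bounded poset is a subset \<open>P\<close> of an ordered type, with the inherited order,
  that contains the top of the type.  Values of \<open>T\<close> outside \<open>P \<times> P\<close> play no role, so this
  also expresses that the restriction of \<open>T\<close> to \<open>P \<times> P\<close> is a t-norm on \<open>P\<close>.\<close>

definition t_norm_on :: "'a::order_top set \<Rightarrow> ('a \<Rightarrow> 'a \<Rightarrow> 'a) \<Rightarrow> bool" where
  "t_norm_on P T \<longleftrightarrow>
     top \<in> P \<and>
     (\<forall>x\<in>P. \<forall>y\<in>P. T x y \<in> P) \<and>
     (\<forall>y\<in>P. mono_on P (\<lambda>x. T x y)) \<and>
     (\<forall>x\<in>P. mono_on P (\<lambda>y. T x y)) \<and>
     (\<forall>x\<in>P. \<forall>y\<in>P. T x y = T y x) \<and>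
     (\<forall>x\<in>P. \<forall>y\<in>P. \<forall>z\<in>P. T (T x y) z = T x (T y z)) \<and>
     (\<forall>x\<in>P. T top x = x)"


section \<open>The atomistic extension of a finite lattice\<close>

text \<open>\<open>Inl x\<close> represents \<open>x \<in> L\<close> and \<open>Inr p\<close> represents the new atom \<open>w\<^sub>p\<close>
  for \<open>p \<in> H(L)\<close>.\<close>

typedef (overloaded) ('a::"{finite,bounded_lattice}") tilde =
  "(UNIV :: 'a set) <+> (nonatom_irreducibles :: 'a set)"
  by blast

setup_lifting type_definition_tilde

lift_definition emb :: "'a::{finite,bounded_lattice} \<Rightarrow> 'a tilde" is Inl
  by blast

text \<open>The element \<open>w\<^sub>p\<close>; unspecified unless \<open>p \<in> nonatom_irreducibles\<close>.\<close>

definition new_atom :: "'a::{finite,bounded_lattice} \<Rightarrow> 'a tilde" where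
  "new_atom p = Abs_tilde (Inr p)"

lemma nonatom_irreducibles_not_bot: "p \<in> nonatom_irreducibles \<Longrightarrow> p \<noteq> bot"
  by (simp add: nonatom_irreducibles_def join_irreducibles_def)

fun tilde_le :: "'a::bounded_lattice + 'a \<Rightarrow> 'a + 'a \<Rightarrow> bool" where
  "tilde_le (Inl x) (Inl y) \<longleftrightarrow> x \<le> y"
| "tilde_le (Inl x) (Inr q) \<longleftrightarrow> x = bot"
| "tilde_le (Inr p) (Inl y) \<longleftrightarrow> p \<le> y"
| "tilde_le (Inr p) (Inr q) \<longleftrightarrow> p = q"

fun tilde_sup :: "'a::bounded_lattice + 'a \<Rightarrow> 'a + 'a \<Rightarrow> 'a + 'a" where
  "tilde_sup (Inl x) (Inl y) = Inl (sup x y)"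
| "tilde_sup (Inl x) (Inr q) = (if x = bot then Inr q else Inl (sup x q))"
| "tilde_sup (Inr p) (Inl y) = (if y = bot then Inr p else Inl (sup p y))"
| "tilde_sup (Inr p) (Inr q) = (if p = q then Inr p else Inl (sup p q))"

fun tilde_inf :: "'a::bounded_lattice + 'a \<Rightarrow> 'a + 'a \<Rightarrow> 'a + 'a" where
  "tilde_inf (Inl x) (Inl y) = Inl (inf x y)"
| "tilde_inf (Inl x) (Inr q) = (if q \<le> x then Inr q else Inl bot)"
| "tilde_inf (Inr p) (Inl y) = (if p \<le> y then Inr p else Inl bot)"
| "tilde_inf (Inr p) (Inr q) = (if p = q then Inr p else Inl bot)"

instance tilde :: ("{finite,bounded_lattice}") finite
proof
  have "finite ((UNIV :: 'a set) <+> (nonatom_irreducibles :: 'a set))"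
    by simp
  then show "finite (UNIV :: 'a tilde set)"
    by (metis finite_imageI type_definition.Abs_image type_definition_tilde)
qed

instantiation tilde :: ("{finite,bounded_lattice}") bounded_lattice
begin

lift_definition less_eq_tilde :: "'a tilde \<Rightarrow> 'a tilde \<Rightarrow> bool" is tilde_le .

definition less_tilde :: "'a tilde \<Rightarrow> 'a tilde \<Rightarrow> bool" where
  "less_tilde x y \<longleftrightarrow> x \<le> y \<and> \<not> y \<le> x"

lift_definition sup_tilde :: "'a tilde \<Rightarrow> 'a tilde \<Rightarrow> 'a tilde" is tilde_sup
  subgoal for x y by (cases x; cases y) auto
  done

lift_definition inf_tilde :: "'a tilde \<Rightarrow> 'a tilde \<Rightarrow> 'a tilde" is tilde_inf
  subgoal for x y by (cases x; cases y) auto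
  done

definition bot_tilde :: "'a tilde" where "bot = emb bot"

definition top_tilde :: "'a tilde" where "top = emb top"

instance
proof
  fix x y z :: "'a tilde"
  show "x < y \<longleftrightarrow> x \<le> y \<and> \<not> y \<le> x"
    by (fact less_tilde_def)
  show "x \<le> x"
    by transfer (auto elim!: PlusE)
  show "x \<le> y \<Longrightarrow> y \<le> z \<Longrightarrow> x \<le> z"
    by transfer (auto elim!: PlusE dest: nonatom_irreducibles_not_bot simp: bot_unique)
  show "x \<le> y \<Longrightarrow> y \<le> x \<Longrightarrow> x = y"
    by transfer (auto elim!: PlusE dest: nonatom_irreducibles_not_bot simp: bot_unique)
  show "inf x y \<le> x"
    by transfer (auto elim!: PlusE)
  show "inf x y \<le> y"
    by transfer (auto elim!: PlusE)
  show "x \<le> y \<Longrightarrow> x \<le> z \<Longrightarrow> x \<le> inf y z"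
    by transfer (auto elim!: PlusE dest: nonatom_irreducibles_not_bot simp: bot_unique)
  show "x \<le> sup x y"
    by transfer (auto elim!: PlusE)
  show "y \<le> sup x y"
    by transfer (auto elim!: PlusE)
  show "y \<le> x \<Longrightarrow> z \<le> x \<Longrightarrow> sup y z \<le> x"
    by transfer (auto elim!: PlusE dest: nonatom_irreducibles_not_bot simp: bot_unique)
  show "bot \<le> x"
    unfolding bot_tilde_def by transfer (auto elim!: PlusE)
  show "x \<le> top"
    unfolding top_tilde_def by transfer (auto elim!: PlusE)
qed

end

instantiation tilde :: ("{finite,bounded_lattice}") finite_lattice_complete
begin

definition Inf_tilde :: "'a tilde set \<Rightarrow> 'a tilde" where
  "Inf_tilde A = Finite_Set.fold inf top A"

definition Sup_tilde :: "'a tilde set \<Rightarrow> 'a tilde" where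
  "Sup_tilde A = Finite_Set.fold sup bot A"

instance
proof
  show "(bot :: 'a tilde) = Inf_fin UNIV"
    by (metis Inf_fin.coboundedI UNIV_I bot.extremum_uniqueI finite_UNIV)
  show "(top :: 'a tilde) = Sup_fin UNIV"
    by (metis Sup_fin.coboundedI UNIV_I top.extremum_uniqueI finite_UNIV)
qed (auto simp: Inf_tilde_def Sup_tilde_def)

end

text \<open>The defining properties of the extension: \<open>L\<close> is a bounded sublattice, and
  \<open>0 \<prec> w\<^sub>p \<prec> p\<close>.\<close>

lemma emb_inject: "emb x = emb y \<longleftrightarrow> x = y"
  by transfer simp

lemma emb_le_iff: "emb x \<le> emb y \<longleftrightarrow> x \<le> y"
  by transfer simp

lemma emb_bot: "emb bot = bot"
  by (simp add: bot_tilde_def)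

lemma emb_top: "emb top = top"
  by (simp add: top_tilde_def)

lemma emb_sup: "emb (sup x y) = sup (emb x) (emb y)"
  by transfer simp

lemma emb_inf: "emb (inf x y) = inf (emb x) (emb y)"
  by transfer simp

lemma Rep_tilde_emb: "Rep_tilde (emb x) = Inl x"
  by (fact emb.rep_eq)

lemma Rep_tilde_new_atom: "p \<in> nonatom_irreducibles \<Longrightarrow> Rep_tilde (new_atom p) = Inr p"
  by (simp add: new_atom_def Abs_tilde_inverse InrI)

lemma tilde_cases:
  obtains x where "t = emb x" | p where "p \<in> nonatom_irreducibles" "t = new_atom p"
  using Rep_tilde[of t]
  by (metis PlusE Rep_tilde_emb Rep_tilde_inject Rep_tilde_new_atom)

lemma new_atom_inject:
  "p \<in> nonatom_irreducibles \<Longrightarrow> q \<in> nonatom_irreducibles \<Longrightarrow> new_atom p = new_atom q \<longleftrightarrow> p = q"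
  by (metis Rep_tilde_new_atom sum.inject(2))

lemma new_atom_not_emb: "p \<in> nonatom_irreducibles \<Longrightarrow> new_atom p \<noteq> emb x"
  by (metis Inl_Inr_False Rep_tilde_emb Rep_tilde_new_atom)

lemma new_atom_le_emb_iff: "p \<in> nonatom_irreducibles \<Longrightarrow> new_atom p \<le> emb x \<longleftrightarrow> p \<le> x"
  by (simp add: less_eq_tilde.rep_eq Rep_tilde_emb Rep_tilde_new_atom)

lemma emb_le_new_atom_iff: "p \<in> nonatom_irreducibles \<Longrightarrow> emb x \<le> new_atom p \<longleftrightarrow> x = bot"
  by (simp add: less_eq_tilde.rep_eq Rep_tilde_emb Rep_tilde_new_atom)

lemma new_atom_le_new_atom_iff:
  "p \<in> nonatom_irreducibles \<Longrightarrow> q \<in> nonatom_irreducibles \<Longrightarrow>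
    new_atom p \<le> new_atom q \<longleftrightarrow> p = q"
  by (simp add: less_eq_tilde.rep_eq Rep_tilde_new_atom)

lemmas tilde_le_iffs =
  emb_le_iff new_atom_le_emb_iff emb_le_new_atom_iff new_atom_le_new_atom_iff

lemma covers_new_atom_bot:
  assumes p: "p \<in> nonatom_irreducibles"
  shows "covers (new_atom p) bot"
proof -
  have "z = bot \<or> z = new_atom p" if "z \<le> new_atom p" for z
    using that p by (cases z rule: tilde_cases) (auto simp: tilde_le_iffs emb_bot)
  moreover have "new_atom p \<noteq> bot"
    using new_atom_not_emb[OF p] by (metis emb_bot)
  ultimately show ?thesis
    unfolding covers_def by (metis bot.not_eq_extremum less_le)
qed

lemma covers_emb_new_atom:
  assumes p: "p \<in> nonatom_irreducibles"
  shows "covers (emb p) (new_atom p)"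
proof -
  have "z = emb p \<or> z = new_atom p" if "new_atom p \<le> z" "z \<le> emb p" for z
    using that p by (cases z rule: tilde_cases) (auto simp: tilde_le_iffs emb_inject)
  moreover have "new_atom p \<le> emb p"
    using p by (simp add: tilde_le_iffs)
  ultimately show ?thesis
    unfolding covers_def using new_atom_not_emb[OF p] by (metis less_le)
qed

lemma atoms_tilde: "atoms = emb ` atoms \<union> new_atom ` nonatom_irreducibles"
proof (rule set_eqI)
  fix t :: "'a tilde"
  show "t \<in> atoms \<longleftrightarrow> t \<in> emb ` atoms \<union> new_atom ` nonatom_irreducibles"
  proof (cases t rule: tilde_cases)
    case (1 x)
    have less: "emb y < emb z \<longleftrightarrow> y < z" for y z :: 'a
      by (simp add: less_le emb_le_iff emb_inject)
    have "covers (emb x) bot \<longleftrightarrow> covers x bot"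
    proof
      assume c: "covers (emb x) bot"
      then show "covers x bot"
        unfolding covers_def by (metis emb_bot less)
    next
      assume c: "covers x bot"
      have "z = bot" if "z < emb x" for z
      proof (cases z rule: tilde_cases)
        case (1 y)
        with that c show ?thesis
          unfolding covers_def by (metis bot.not_eq_extremum emb_bot less)
      next
        case (2 p)
        with that have "p \<le> x"
          using new_atom_le_emb_iff less_le by metis
        moreover have "p \<noteq> bot" "\<not> covers p bot"
          using 2(1) nonatom_irreducibles_not_bot[OF 2(1)]
          by (auto simp: nonatom_irreducibles_def atoms_def)
        ultimately show ?thesis
          using c unfolding covers_def by (metis bot.not_eq_extremum less_le)
      qed
      with c show "covers (emb x) bot"
        unfolding covers_def by (metis emb_bot less order.irrefl)
    qed
    with 1 show ?thesis
      by (auto simp: atoms_def emb_inject new_atom_not_emb[THEN not_sym])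
  next
    case (2 p)
    then show ?thesis
      using covers_new_atom_bot[of p] by (auto simp: atoms_def)
  qed
qed


section \<open>The construction of the t-norm\<close>

definition atom_frame :: "'a::{order_bot,order_top} set" where
  "atom_frame = atoms \<union> {bot, top}"

definition kappa :: "'a::{order_bot,order_top} \<Rightarrow> 'a set" where
  "kappa x = {u \<in> atom_frame - {bot}. u \<le> x}"

definition t_ext :: "('a \<Rightarrow> 'a \<Rightarrow> 'a) \<Rightarrow> 'a \<Rightarrow> 'a \<Rightarrow> 'a::finite_lattice_complete" where
  "t_ext T x y = (SUP u\<in>kappa x. SUP v\<in>kappa y. T u v)"

definition condition_C ::
  "('a tilde \<Rightarrow> 'a tilde \<Rightarrow> 'a::{finite,bounded_lattice} tilde) \<Rightarrow> bool" where
  "condition_C T \<longleftrightarrow>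
     (\<forall>p \<in> nonatom_irreducibles - {top}.
        T (new_atom p) (new_atom p) \<noteq> bot \<longrightarrow>
        (\<exists>u \<in> atoms_below (emb p) - {new_atom p}. T u u \<noteq> bot))"

end

theory Submission
  imports Defs
begin

text \<open>Two distinct atoms have product \<open>0\<close> under a t-norm on \<open>A \<union> {0, 1}\<close>, and an atom
  \<open>a\<close> satisfies \<open>T a a \<in> {0, a}\<close>.  Hence for \<open>x, y \<noteq> 1\<close> the extension \<open>t_ext T x y\<close> is the
  join of the idempotent atoms below \<open>inf x y\<close>, which makes associativity evident.  The restriction
  to \<open>L\<close> is then a t-norm iff \<open>L\<close> is closed under the operation.  The join of two distinct atoms of the
  extended lattice lies in \<open>L\<close>, so closure fails exactly if some \<open>w\<^sub>p\<close> is the only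
  idempotent atom below some \<open>x \<noteq> 1\<close> in \<open>L\<close>; as \<open>p \<le> x\<close>, one may then take \<open>x = p\<close>.\<close>

section \<open>Atoms and the restriction of t-norms\<close>

lemma atom_le_atom_iff:
  assumes "a \<in> atoms" and "b \<in> atoms"
  shows "a \<le> b \<longleftrightarrow> a = b"
  using assms unfolding atoms_def covers_def by (auto simp: less_le)

lemma atom_not_bot: "a \<in> atoms \<Longrightarrow> a \<noteq> bot"
  by (auto simp: atoms_def covers_def)

lemma le_atom_cases:
  assumes "a \<in> atoms" and "x \<le> a"
  shows "x = bot \<or> x = a"
  using assms unfolding atoms_def covers_def by (auto simp: less_le)

lemma kappa_not_top: "x \<noteq> top \<Longrightarrow> kappa x = atoms_below x"
  by (auto simp: kappa_def atom_frame_def atoms_below_def top_unique dest: atom_not_bot)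

lemma kappa_subset_frame: "kappa x \<subseteq> atom_frame"
  by (auto simp: kappa_def)

lemma kappa_mono: "x \<le> y \<Longrightarrow> kappa x \<subseteq> kappa y"
  by (auto simp: kappa_def)

text \<open>The laws of a t-norm pass to subsets, so for the restriction to L only closure will
  remain to be checked.\<close>

lemma t_norm_on_subset:
  assumes "t_norm_on Q T" and "P \<subseteq> Q" and "top \<in> P"
    and "\<And>x y. x \<in> P \<Longrightarrow> y \<in> P \<Longrightarrow> T x y \<in> P"
  shows "t_norm_on P T"
  unfolding t_norm_on_def
proof (intro conjI ballI)
  have P: "\<And>x. x \<in> P \<Longrightarrow> x \<in> Q"
    using \<open>P \<subseteq> Q\<close> by blast
  fix x y z assume "x \<in> P" "y \<in> P" "z \<in> P"
  then show "T x y = T y x" "T (T x y) z = T x (T y z)"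
    using \<open>t_norm_on Q T\<close> P unfolding t_norm_on_def by blast+
next
  fix x assume "x \<in> P"
  then have "x \<in> Q"
    using \<open>P \<subseteq> Q\<close> by blast
  then have "mono_on Q (\<lambda>y. T y x)" "mono_on Q (T x)" "T top x = x"
    using \<open>t_norm_on Q T\<close> unfolding t_norm_on_def by blast+
  then show "mono_on P (\<lambda>y. T y x)" "mono_on P (T x)" "T top x = x"
    using \<open>P \<subseteq> Q\<close> by (auto intro: mono_on_subset)
qed (use assms(3,4) in auto)

text \<open>By monotonicity, raising one factor to \<open>top\<close> bounds the product by the
  other factor.\<close>

lemma t_norm_on_le:
  assumes T: "t_norm_on P T" and x: "x \<in> P" and y: "y \<in> P"
  shows "T x y \<le> x" and "T x y \<le> y"
proof -
  have top: "top \<in> P" and comm: "T x y = T y x" and neutral: "T top x = x" "T top y = y"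
    and mono: "\<And>z. z \<in> P \<Longrightarrow> mono_on P (\<lambda>x. T x z)"
    using T x y unfolding t_norm_on_def by blast+
  show "T x y \<le> y"
    using mono_onD[OF mono[OF y] x top] by (simp add: neutral)
  show "T x y \<le> x"
    using mono_onD[OF mono[OF x] y top] by (simp add: neutral comm)
qed

text \<open>For a t-norm on the frame and an atom \<open>a\<close>, \<open>T a a\<close> is
  \<open>bot\<close> or \<open>a\<close>; so \<open>T a a \<noteq> bot\<close> expresses
  idempotence.\<close>

definition idempotent_atoms_below ::
  "('a \<Rightarrow> 'a \<Rightarrow> 'a) \<Rightarrow> 'a \<Rightarrow> 'a::order_bot set" where
  "idempotent_atoms_below T x = {a \<in> atoms_below x. T a a \<noteq> bot}"

section \<open>The extension of a t-norm from the frame to a finite lattice\<close>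

locale frame_t_norm =
  fixes T :: "'a::finite_lattice_complete \<Rightarrow> 'a \<Rightarrow> 'a"
  assumes T: "t_norm_on atom_frame T"
begin

lemma comm: "x \<in> atom_frame \<Longrightarrow> y \<in> atom_frame \<Longrightarrow> T x y = T y x"
  using T unfolding t_norm_on_def by blast

lemma T_top: "x \<in> atom_frame \<Longrightarrow> T top x = x"
  using T unfolding t_norm_on_def by blast

text \<open>The product lies below both factors, and below an atom there are only \<open>bot\<close>
  and the atom itself.\<close>

lemma T_atoms:
  assumes a: "a \<in> atoms" and b: "b \<in> atoms"
  shows "T a b = (if a = b \<and> T a a \<noteq> bot then a else bot)"
proof -
  have "a \<in> atom_frame" "b \<in> atom_frame"
    using a b by (auto simp: atom_frame_def)
  then have "T a b \<le> a" "T a b \<le> b"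
    using t_norm_on_le[OF T] by blast+
  with le_atom_cases[OF a] le_atom_cases[OF b] have "T a b = bot \<or> T a b = a" "T a b = bot \<or> T a b = b"
    by blast+
  then show ?thesis
    by auto
qed

lemma t_ext_le_iff:
  "t_ext T x y \<le> z \<longleftrightarrow> (\<forall>u\<in>kappa x. \<forall>v\<in>kappa y. T u v \<le> z)"
  by (simp add: t_ext_def SUP_le_iff)

lemma t_ext_mono: "x \<le> x' \<Longrightarrow> y \<le> y' \<Longrightarrow> t_ext T x y \<le> t_ext T x' y'"
  unfolding t_ext_def by (intro SUP_subset_mono kappa_mono) auto

lemma T_le_t_ext: "u \<in> kappa x \<Longrightarrow> v \<in> kappa y \<Longrightarrow> T u v \<le> t_ext T x y"
  using t_ext_le_iff[of x y "t_ext T x y"] by blast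

lemma t_ext_comm: "t_ext T x y = t_ext T y x"
proof -
  have "t_ext T x y \<le> t_ext T y x" for x y
    unfolding t_ext_le_iff
  proof (intro ballI)
    fix u v assume uv: "u \<in> kappa x" "v \<in> kappa y"
    then have "T u v = T v u"
      using comm kappa_subset_frame by blast
    with T_le_t_ext[OF uv(2,1)] show "T u v \<le> t_ext T y x"
      by simp
  qed
  then show ?thesis
    by (intro order_antisym)
qed

lemma t_ext_le_right: "t_ext T x y \<le> y"
proof -
  have "T u v \<le> y" if "u \<in> kappa x" "v \<in> kappa y" for u v
  proof -
    have "T u v \<le> v"
      using t_norm_on_le(2)[OF T] that kappa_subset_frame by blast
    also have "v \<le> y"
      using that by (simp add: kappa_def)
    finally show ?thesis .
  qed
  then show ?thesis
    by (simp add: t_ext_le_iff)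
qed

lemma t_ext_le_left: "t_ext T x y \<le> x"
  by (subst t_ext_comm) (rule t_ext_le_right)

text \<open>Here \<open>kappa\<close> yields only atoms, and by \<open>T_atoms\<close> the pairs
  \<open>u \<noteq> v\<close> contribute \<open>bot\<close>. The diagonal pairs are the atoms below
  both arguments, and the idempotent ones among them contribute themselves.\<close>

lemma t_ext_not_top:
  assumes x: "x \<noteq> top" and y: "y \<noteq> top"
  shows "t_ext T x y = Sup (idempotent_atoms_below T (inf x y))"
proof (rule order_antisym)
  show "t_ext T x y \<le> Sup (idempotent_atoms_below T (inf x y))"
    unfolding t_ext_le_iff kappa_not_top[OF x] kappa_not_top[OF y]
    by (auto simp: T_atoms atoms_below_def idempotent_atoms_below_def intro!: Sup_upper)
  have "a \<le> t_ext T x y" if "a \<in> idempotent_atoms_below T (inf x y)" for a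
  proof -
    have "a \<in> kappa x" "a \<in> kappa y" "T a a = a"
      using that T_atoms[of a a]
      by (auto simp: kappa_not_top x y idempotent_atoms_below_def atoms_below_def)
    then show ?thesis
      using T_le_t_ext by metis
  qed
  then show "Sup (idempotent_atoms_below T (inf x y)) \<le> t_ext T x y"
    by (rule Sup_least)
qed

text \<open>Atomisticity enters here: the pairs of \<open>top\<close> with the atoms below
  \<open>x\<close> already give a join of at least \<open>x\<close>.\<close>

lemma t_ext_top:
  assumes atomistic: "\<And>x::'a. Sup (atoms_below x) = x"
  shows "t_ext T top x = x"
proof (rule order_antisym[OF t_ext_le_right])
  have "a \<le> t_ext T top x" if "a \<in> atoms_below x" for a
  proof -
    have a: "a \<in> atoms" "a \<le> x" "a \<noteq> bot"
      using that by (auto simp: atoms_below_def atom_not_bot)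
    \<comment> \<open>Since \<open>kappa\<close> omits \<open>bot\<close>, membership of
      \<open>top\<close> in \<open>kappa top\<close> needs a nontrivial lattice, which the atom
      \<open>a\<close> guarantees.\<close>
    then have "(top::'a) \<noteq> bot"
      using top_greatest[of a] bot_unique by metis
    then have "top \<in> kappa (top::'a)" "a \<in> kappa x" "T top a = a"
      using a by (auto simp: kappa_def atom_frame_def intro: T_top)
    then show ?thesis
      using T_le_t_ext by metis
  qed
  then have "Sup (atoms_below x) \<le> t_ext T top x"
    by (rule Sup_least)
  then show "x \<le> t_ext T top x"
    by (simp add: atomistic)
qed

text \<open>Away from \<open>top\<close>, both sides are the join of the idempotent atoms below all
  of \<open>x\<close>, \<open>y\<close> and \<open>z\<close>; if an argument is \<open>top\<close>,
  neutrality settles it.\<close>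

lemma t_ext_assoc:
  assumes atomistic: "\<And>x::'a. Sup (atoms_below x) = x"
  shows "t_ext T (t_ext T x y) z = t_ext T x (t_ext T y z)"
proof (cases "x = top \<or> y = top \<or> z = top")
  case True
  then show ?thesis
    using t_ext_top[OF atomistic] t_ext_comm by metis
next
  case False
  then have nt: "x \<noteq> top" "y \<noteq> top" "z \<noteq> top"
    by auto
  \<comment> \<open>The inner products lie below \<open>x\<close> and \<open>y\<close>, so
    \<open>t_ext_not_top\<close> also applies to the outer products.\<close>
  have ne: "t_ext T x y \<noteq> top" "t_ext T y z \<noteq> top"
    using t_ext_le_left nt top_unique by metis+
  have below: "a \<le> t_ext T u v \<longleftrightarrow> a \<le> inf u v"
    if "a \<in> atoms" "T a a \<noteq> bot" "u \<noteq> top" "v \<noteq> top" for a u v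
  proof
    show "a \<le> inf u v" if "a \<le> t_ext T u v"
      using that t_ext_le_left t_ext_le_right by (metis le_infI order_trans)
    show "a \<le> t_ext T u v" if "a \<le> inf u v"
      unfolding t_ext_not_top[OF \<open>u \<noteq> top\<close> \<open>v \<noteq> top\<close>]
      using that \<open>a \<in> atoms\<close> \<open>T a a \<noteq> bot\<close>
      by (intro Sup_upper) (simp add: idempotent_atoms_below_def atoms_below_def)
  qed
  have "idempotent_atoms_below T (inf (t_ext T x y) z)
      = idempotent_atoms_below T (inf x (t_ext T y z))"
    using below nt by (auto simp: idempotent_atoms_below_def atoms_below_def)
  then show ?thesis
    using nt ne by (simp add: t_ext_not_top[of "t_ext T x y" z] t_ext_not_top[of x "t_ext T y z"])
qed

lemma t_norm_on_t_ext:
  assumes "\<And>x::'a. Sup (atoms_below x) = x"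
  shows "t_norm_on UNIV (t_ext T)"
  unfolding t_norm_on_def
proof (intro conjI ballI)
  fix x y z :: 'a
  show "t_ext T x y = t_ext T y x"
    by (rule t_ext_comm)
  show "t_ext T (t_ext T x y) z = t_ext T x (t_ext T y z)"
    by (rule t_ext_assoc[OF assms])
qed (auto intro!: mono_onI t_ext_mono t_ext_top[OF assms])

end

section \<open>Joins of atoms in the extended lattice\<close>

lemma tilde_atomistic:
  fixes t :: "'a::{finite,bounded_lattice} tilde"
  shows "Sup (atoms_below t) = t"
proof (rule order_antisym)
  show "Sup (atoms_below t) \<le> t"
    by (rule Sup_least) (simp add: atoms_below_def)
  \<comment> \<open>Induction along the order of L, measured by the size of the down-set: a proper
    join reduces to its parts, and an irreducible \<open>x\<close> is an atom or has its own new
    atom below it.\<close>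
  have emb: "emb x \<le> y" if "\<And>a. a \<in> atoms \<Longrightarrow> a \<le> emb x \<Longrightarrow> a \<le> y" for x :: 'a and y
    using that
  proof (induction "card {..x}" arbitrary: x rule: less_induct)
    case less
    have IH: "emb z \<le> y" if "z < x" for z
    proof (rule less.hyps)
      show "card {..z} < card {..x}"
        using that by (intro psubset_card_mono) auto
      show "a \<le> y" if "a \<in> atoms" "a \<le> emb z" for a
        using less.prems that \<open>z < x\<close> by (meson emb_le_iff less_imp_le order_trans)
    qed
    show "emb x \<le> y"
    proof (cases "x \<in> join_irreducibles")
      case False
      then consider "x = bot" | a b where "x = sup a b" "x \<noteq> a" "x \<noteq> b"
        by (auto simp: join_irreducibles_def)
      then show ?thesis
      proof cases
        case 2
        then have "a < x" "b < x"
          by (metis less_le sup_ge1, metis less_le sup_ge2)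
        then show ?thesis
          using 2(1) IH by (simp add: emb_sup)
      qed (simp add: emb_bot)
    next
      case irr: True
      show ?thesis
      proof (cases "x \<in> atoms")
        case True
        then show ?thesis
          using less.prems by (auto simp: atoms_tilde)
      next
        case False
        with irr have x: "x \<in> nonatom_irreducibles"
          by (simp add: nonatom_irreducibles_def)
        then have w: "new_atom x \<le> y"
          using less.prems by (simp add: atoms_tilde tilde_le_iffs)
        \<comment> \<open>By induction \<open>emb z \<le> y\<close> with \<open>z\<close> nonzero,
          so \<open>y\<close> is not a new atom. For \<open>y\<close> in L, lying above
          \<open>new_atom x\<close> means lying above \<open>x\<close>.\<close>
        obtain z where z: "bot < z" "z < x"
          using False nonatom_irreducibles_not_bot[OF x]
          by (auto simp: atoms_def covers_def bot.not_eq_extremum)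
        show ?thesis
        proof (cases y rule: tilde_cases)
          case (1 y')
          with w x show ?thesis
            by (simp add: tilde_le_iffs)
        next
          case (2 q)
          with IH[OF z(2)] z(1) show ?thesis
            by (simp add: tilde_le_iffs)
        qed
      qed
    qed
  qed
  show "t \<le> Sup (atoms_below t)"
  proof (cases t rule: tilde_cases)
    case (1 x)
    show ?thesis
      unfolding 1 by (rule emb) (auto intro!: Sup_upper simp: atoms_below_def)
  next
    case (2 p)
    then show ?thesis
      by (intro Sup_upper) (simp add: atoms_below_def atoms_tilde)
  qed
qed

text \<open>If the join is a new atom, every member of \<open>A\<close> equals it. The singleton is
  excluded, and the empty join is \<open>emb bot\<close>.\<close>

lemma Sup_atoms_in_range_emb:
  fixes A :: "'a::{finite,bounded_lattice} tilde set"
  assumes A: "A \<subseteq> atoms" and no_single: "\<And>p. p \<in> nonatom_irreducibles \<Longrightarrow> A \<noteq> {new_atom p}"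
  shows "Sup A \<in> range emb"
proof (cases "Sup A" rule: tilde_cases)
  case (2 p)
  have "a = new_atom p" if "a \<in> A" for a
    using that A 2 Sup_upper[OF that] atom_le_atom_iff[of a "new_atom p"]
    by (auto simp: atoms_tilde)
  then have "A = {} \<or> A = {new_atom p}"
    by auto
  with no_single[OF 2(1)] have "Sup A = emb bot"
    by (simp add: emb_bot)
  then show ?thesis
    by simp
qed simp

theorem theorem6p2:
  fixes T :: "'a::{finite,bounded_lattice} tilde \<Rightarrow> 'a tilde \<Rightarrow> 'a tilde"
  assumes "t_norm_on atom_frame T"
  shows "t_norm_on (range emb) (t_ext T) \<longleftrightarrow> condition_C T"
proof
  interpret frame_t_norm T
    by standard (fact assms)
  have top: "emb x \<noteq> top" if "x \<noteq> top" for x :: 'a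
    using that by (metis emb_inject emb_top)
  {
    assume L: "t_norm_on (range emb) (t_ext T)"
    show "condition_C T"
      unfolding condition_C_def
    proof (intro ballI impI, rule ccontr)
      fix p :: 'a
      assume p: "p \<in> nonatom_irreducibles - {top}"
        and w: "T (new_atom p) (new_atom p) \<noteq> bot"
        and no: "\<not> (\<exists>u \<in> atoms_below (emb p) - {new_atom p}. T u u \<noteq> bot)"
      \<comment> \<open>If (C) fails at \<open>p\<close>, then \<open>new_atom p\<close> is the only
        idempotent atom below \<open>emb p\<close>; hence the square of \<open>emb p\<close> is
        \<open>new_atom p\<close>, which lies outside L.\<close>
      have "new_atom p \<in> atoms_below (emb p)"
        using p by (auto simp: atoms_below_def atoms_tilde tilde_le_iffs)
      with w no have "idempotent_atoms_below T (emb p) = {new_atom p}"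
        by (auto simp: idempotent_atoms_below_def)
      then have "t_ext T (emb p) (emb p) = new_atom p"
        using p top by (simp add: t_ext_not_top)
      moreover have "t_ext T (emb p) (emb p) \<in> range emb"
        using L by (simp add: t_norm_on_def)
      ultimately show False
        using p by (auto simp: new_atom_not_emb)
    qed
  next
    assume C: "condition_C T"
    have closed: "t_ext T (emb x) (emb y) \<in> range emb" for x y :: 'a
    proof (cases "x = top \<or> y = top")
      case True
      then show ?thesis
        using t_ext_top[OF tilde_atomistic] t_ext_comm by (metis emb_top rangeI)
    next
      case False
      \<comment> \<open>The product is the join of this set, so by
        \<open>Sup_atoms_in_range_emb\<close> only a single new atom could take it out of L.\<close>
      have "idempotent_atoms_below T (emb (inf x y)) \<noteq> {new_atom p}"
        if p: "p \<in> nonatom_irreducibles" for p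
      proof
        assume single: "idempotent_atoms_below T (emb (inf x y)) = {new_atom p}"
        then have "new_atom p \<in> idempotent_atoms_below T (emb (inf x y))"
          by simp
        then have "new_atom p \<le> emb (inf x y)" and w: "T (new_atom p) (new_atom p) \<noteq> bot"
          by (simp_all add: idempotent_atoms_below_def atoms_below_def)
        then have le: "p \<le> inf x y"
          using p by (simp only: new_atom_le_emb_iff)
        \<comment> \<open>This makes (C) applicable at \<open>p\<close>. It yields a second
          idempotent atom below \<open>emb p\<close>, hence below the meet.\<close>
        have "p \<noteq> top"
          using le False top_unique by (metis inf.boundedE)
        with C p w obtain u where "u \<in> atoms_below (emb p)" "u \<noteq> new_atom p" "T u u \<noteq> bot"
          by (auto simp: condition_C_def)
        moreover have "emb p \<le> emb (inf x y)"
          using le by (simp only: emb_le_iff)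
        ultimately have "u \<in> idempotent_atoms_below T (emb (inf x y))"
          by (auto simp: idempotent_atoms_below_def atoms_below_def)
        with single \<open>u \<noteq> new_atom p\<close> show False
          by simp
      qed
      then have "Sup (idempotent_atoms_below T (emb (inf x y))) \<in> range emb"
        by (intro Sup_atoms_in_range_emb)
          (auto simp: idempotent_atoms_below_def atoms_below_def)
      then show ?thesis
        using False top by (simp add: t_ext_not_top emb_inf)
    qed
    show "t_norm_on (range emb) (t_ext T)"
    proof (rule t_norm_on_subset[OF t_norm_on_t_ext[OF tilde_atomistic]])
      show "(top :: 'a tilde) \<in> range emb"
        by (metis emb_top rangeI)
    qed (use closed in auto)
  }
qed

end
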